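(* Let $\rho$ be an $n\times n$ density matrix with spectral decomposition $\rho=\sum_{i=1}^n \lambda_i |\phi_i\rangle\langle\phi_i|$, where $\{\phi_i\}_{i=1}^n$ is an orthonormal basis of $\mathbb{C}^n$ and $0\le\lambda_1\le\lambda_2\le\cdots\le\lambda_n$. Let $A,B$ be $n\times n$ self-adjoint complex matrices and let $q\in\mathbb{R}$. Then the following refined uncertainty relations hold. (1) If $|q|\le 1$, then $$\frac{(\lambda_n+|q|\lambda_1)^2}{(1+|q|)^2(\lambda_n-|q|\lambda_1)^2}\,\bigl|\mathrm{Tr}[\rho[A_0,B_0]_{|q|}]\bigr|^2\le V_\rho(A)V_\rho(B).$$ (2) If $|q|>1$, then $$\frac{q^2(|q|\lambda_n+\lambda_1)^2}{(1+|q|)^2(|q|\lambda_n-\lambda_1)^2}\,\bigl|\mathrm{Tr}[\rho[A_0,B_0]_{1/|q|}]\bigr|^2=\frac{(|q|\lambda_n+\lambda_1)^2}{(1+|q|)^2(|q|\lambda_n-\lambda_1)^2}\,\bigl|\mathrm{Tr}[\rho[B_0,A_0]_{|q|}]\bigr|^2\le V_\rho(A)V_\rho(B).$$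
   Context: A density matrix is a positive semidefinite self-adjoint complex matrix of trace $1$. For self-adjoint matrices $X,Y$ and $r\in\mathbb{R}$, the $q$-commutator with parameter $r$ is $[X,Y]_r=XY-rYX$. For a density matrix $\rho$ and self-adjoint $A$, put $A_0=A-\mathrm{Tr}[\rho A]I$, where $I$ is the identity matrix (and likewise $B_0=B-\mathrm{Tr}[\rho B]I$), and $V_\rho(A)=\mathrm{Tr}[\rho A^2]-(\mathrm{Tr}[\rho A])^2=\mathrm{Tr}[\rho A_0^2]$ (and likewise $V_\rho(B)$). *)

theory Defs
  imports "HOL-Analysis.Analysis"
begin

definition ctranspose :: "complex ^ 'n ^ 'm \<Rightarrow> complex ^ 'm ^ 'n"
  where "ctranspose M = (\<chi> i j. cnj (M $ j $ i))"

definition self_adjoint :: "complex ^ 'n ^ 'n \<Rightarrow> bool"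
  where "self_adjoint M \<longleftrightarrow> ctranspose M = M"

text \<open>The library's inner product on \<^typ>\<open>complex ^ 'n\<close> is the real one; this is the
  complex one, conjugate-linear in the first argument.\<close>

definition cinner :: "complex ^ 'n \<Rightarrow> complex ^ 'n \<Rightarrow> complex"
  where "cinner x y = (\<Sum>i\<in>UNIV. cnj (x $ i) * y $ i)"

text \<open>For self-adjoint \<open>M\<close> the number \<open>cinner x (M *v x)\<close> is real, so that taking its real
  part only changes the type.\<close>

definition pos_semidef :: "complex ^ 'n ^ 'n \<Rightarrow> bool"
  where "pos_semidef M \<longleftrightarrow> self_adjoint M \<and> (\<forall>x. 0 \<le> Re (cinner x (M *v x)))"

definition density_matrix :: "complex ^ 'n ^ 'n \<Rightarrow> bool"
  where "density_matrix \<rho> \<longleftrightarrow> pos_semidef \<rho> \<and> trace \<rho> = 1"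

text \<open>The rank-one operator \<open>|x\<rangle>\<langle>y|\<close>.\<close>

definition ketbra :: "complex ^ 'n \<Rightarrow> complex ^ 'm \<Rightarrow> complex ^ 'm ^ 'n"
  where "ketbra x y = (\<chi> i j. x $ i * cnj (y $ j))"

text \<open>A basis is indexed by \<open>1, \<dots>, n\<close> with \<open>n = CARD('n)\<close>, since the coordinate type \<open>'n\<close>
  carries no order by which eigenvalues could be sorted. Here \<^const>\<open>vec.span\<close> is the
  complex span.\<close>

definition orthonormal_basis :: "(nat \<Rightarrow> complex ^ 'n) \<Rightarrow> bool"
  where "orthonormal_basis \<phi> \<longleftrightarrow>
    (\<forall>i\<in>{1..CARD('n)}. \<forall>j\<in>{1..CARD('n)}. cinner (\<phi> i) (\<phi> j) = (if i = j then 1 else 0)) \<and>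
    vec.span (\<phi> ` {1..CARD('n)}) = UNIV"

definition qcomm :: "real \<Rightarrow> complex ^ 'n ^ 'n \<Rightarrow> complex ^ 'n ^ 'n \<Rightarrow> complex ^ 'n ^ 'n"
  where "qcomm r X Y = X ** Y - r *\<^sub>R (Y ** X)"

definition centered :: "complex ^ 'n ^ 'n \<Rightarrow> complex ^ 'n ^ 'n \<Rightarrow> complex ^ 'n ^ 'n"
  where "centered \<rho> A = A - mat (trace (\<rho> ** A))"

text \<open>The traces below are real for self-adjoint \<open>\<rho>\<close> and \<open>A\<close>, so that taking the real part
  only changes the type (lemma \<open>of_real_variance\<close>).\<close>

definition variance :: "complex ^ 'n ^ 'n \<Rightarrow> complex ^ 'n ^ 'n \<Rightarrow> real"
  where "variance \<rho> A = Re (trace (\<rho> ** (A ** A)) - (trace (\<rho> ** A))\<^sup>2)"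

lemma ctranspose_mult: "ctranspose (A ** B) = ctranspose B ** ctranspose A"
  by (simp add: ctranspose_def matrix_matrix_mult_def vec_eq_iff mult.commute)

lemma trace_ctranspose: "trace (ctranspose A) = cnj (trace A)"
  by (simp add: ctranspose_def trace_def)

lemma cnj_trace_mult:
  assumes "self_adjoint A" "self_adjoint B"
  shows "cnj (trace (A ** B)) = trace (A ** B)"
  using assms by (metis ctranspose_mult self_adjoint_def trace_ctranspose trace_mul_sym)

lemma of_real_variance:
  assumes "self_adjoint \<rho>" "self_adjoint A"
  shows "of_real (variance \<rho> A) = trace (\<rho> ** (A ** A)) - (trace (\<rho> ** A))\<^sup>2"
proof -
  have "self_adjoint (A ** A)"
    using assms by (simp add: self_adjoint_def ctranspose_mult)
  then have "cnj (trace (\<rho> ** (A ** A)) - (trace (\<rho> ** A))\<^sup>2)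
      = trace (\<rho> ** (A ** A)) - (trace (\<rho> ** A))\<^sup>2"
    using assms by (simp add: cnj_trace_mult)
  then show ?thesis
    unfolding variance_def by (metis Reals_cnj_iff of_real_Re)
qed

end

theory Submission
  imports Defs
begin

text \<open>
  Write \<open>q\<close> for \<open>|q|\<close>, let \<open>\<lambda>\<^sub>i\<close> be the eigenvalues of \<open>\<rho>\<close>, and in the eigenbasis put
  \<open>a\<^sub>i\<^sub>j = \<langle>\<phi>\<^sub>i|A\<^sub>0 \<phi>\<^sub>j\<rangle>\<close> and \<open>b\<^sub>i\<^sub>j = \<langle>\<phi>\<^sub>i|B\<^sub>0 \<phi>\<^sub>j\<rangle>\<close>. The trace of \<open>\<rho> [A\<^sub>0, B\<^sub>0]\<^sub>q\<close> is the sum of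
  \<open>(\<lambda>\<^sub>i - q \<lambda>\<^sub>j) a\<^sub>i\<^sub>j b\<^sub>j\<^sub>i\<close>, and the variance of \<open>A\<close> is the sum of \<open>\<lambda>\<^sub>i |a\<^sub>i\<^sub>j|\<^sup>2\<close>. The moduli of
  \<open>a\<^sub>i\<^sub>j\<close> and \<open>b\<^sub>i\<^sub>j\<close> are symmetric in \<open>i\<close> and \<open>j\<close>, so the variance is also half the sum of
  \<open>(\<lambda>\<^sub>i + \<lambda>\<^sub>j) |a\<^sub>i\<^sub>j|\<^sup>2\<close>, and the trace has modulus at most half the sum of
  \<open>(|\<lambda>\<^sub>i - q \<lambda>\<^sub>j| + |\<lambda>\<^sub>j - q \<lambda>\<^sub>i|) |a\<^sub>i\<^sub>j| |b\<^sub>i\<^sub>j|\<close>. For \<open>0 \<le> q \<le> 1\<close> and eigenvalues between \<open>l\<close> and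
  \<open>L\<close>, the bracket is at most \<open>c (\<lambda>\<^sub>i + \<lambda>\<^sub>j)\<close> with \<open>c = (1 + q) (L - q l) / (L + q l)\<close>
  (\<open>abs_q_difference_pair_le\<close>), and Cauchy--Schwarz with the weights \<open>\<lambda>\<^sub>i + \<lambda>\<^sub>j\<close> gives the
  relation (\<open>q_weighted_sum_bound\<close>, \<open>uncertainty_qcomm\<close>). For \<open>q > 1\<close> it is applied to \<open>1 / q\<close>,
  since \<open>[B\<^sub>0, A\<^sub>0]\<^sub>q = - q [A\<^sub>0, B\<^sub>0]\<^bsub>1/q\<^esub>\<close>.
\<close>

section \<open>Double sums with q-deformed weights\<close>

text \<open>For reals, \<open>|u| + |v|\<close> is the larger of \<open>|u + v|\<close> and \<open>|u - v|\<close>; here these are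
  \<open>(1 - q) (x + y)\<close> and \<open>(1 + q) |x - y|\<close>. The bound for the first amounts to \<open>l \<le> L\<close>, that for
  the second (if \<open>y \<le> x\<close>) to \<open>q l x \<le> L y\<close>, which holds since \<open>q \<le> 1\<close>, \<open>l \<le> y\<close> and \<open>x \<le> L\<close>.
  In this form, without division by \<open>L + q l\<close>, the bound covers \<open>L = 0\<close> as well.\<close>

lemma abs_q_difference_pair_le:
  fixes q l L x y :: real
  assumes q: "0 \<le> q" "q \<le> 1" and l: "0 \<le> l" and x: "l \<le> x" "x \<le> L" and y: "l \<le> y" "y \<le> L"
  shows "(L + q * l) * (\<bar>x - q * y\<bar> + \<bar>y - q * x\<bar>) \<le> (1 + q) * (L - q * l) * (x + y)"
proof -
  let ?c = "(1 + q) * (L - q * l) * (x + y)"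
  have ql: "q * l \<le> L" "0 \<le> L" "0 \<le> q * l"
    using mult_left_le_one_le[OF l q] q l x by auto
  have "(1 - q) * (L + q * l) \<le> (1 + q) * (L - q * l)"
    using mult_left_mono[of l L "2 * q"] q x by (simp add: algebra_simps)
  from mult_right_mono[OF this, of "x + y"]
  have plus: "(L + q * l) * \<bar>(1 - q) * (x + y)\<bar> \<le> ?c"
    using q l x y by (simp add: abs_mult mult_ac)
  have ord: "(L + q * l) * (s - t) \<le> (L - q * l) * (s + t)"
    if s: "l \<le> s" "s \<le> L" and t: "l \<le> t" "t \<le> L" for s t
  proof -
    have "q * l * s \<le> l * s" using q l s by (intro mult_right_mono mult_left_le_one_le) auto
    also have "\<dots> \<le> t * L" using l s t by (intro mult_mono) auto
    finally show ?thesis by (simp add: algebra_simps)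
  qed
  have "(L + q * l) * \<bar>x - y\<bar> \<le> (L - q * l) * (x + y)"
    using ord[OF x y] ord[OF y x] by (auto simp: abs_if add.commute)
  from mult_left_mono[OF this, of "1 + q"]
  have minus: "(L + q * l) * \<bar>(1 + q) * (x - y)\<bar> \<le> ?c"
    using q by (simp add: abs_mult mult_ac)
  have "\<bar>u\<bar> + \<bar>v\<bar> = \<bar>u + v\<bar> \<or> \<bar>u\<bar> + \<bar>v\<bar> = \<bar>u - v\<bar>" for u v :: real by arith
  from this[of "x - q * y" "y - q * x"]
  have "\<bar>x - q * y\<bar> + \<bar>y - q * x\<bar> = \<bar>(1 - q) * (x + y)\<bar> \<or>
      \<bar>x - q * y\<bar> + \<bar>y - q * x\<bar> = \<bar>(1 + q) * (x - y)\<bar>"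
    by (simp add: algebra_simps)
  then show ?thesis using plus minus by metis
qed

lemma Cauchy_Schwarz_ineq_weighted_sum:
  fixes w f g :: "'i \<Rightarrow> real"
  assumes "\<And>i. i \<in> I \<Longrightarrow> 0 \<le> w i"
  shows "(\<Sum>i\<in>I. w i * (f i * g i))\<^sup>2 \<le> (\<Sum>i\<in>I. w i * (f i)\<^sup>2) * (\<Sum>i\<in>I. w i * (g i)\<^sup>2)"
proof -
  have eq: "(\<Sum>i\<in>I. w i * h i) = (\<Sum>i\<in>I. (sqrt (w i) * sqrt (w i)) * h i)" for h
    using assms by (intro sum.cong) auto
  show ?thesis
    using Cauchy_Schwarz_ineq_sum[of "\<lambda>i. sqrt (w i) * f i" "\<lambda>i. sqrt (w i) * g i" I]
    unfolding eq by (simp add: power2_eq_square mult_ac)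
qed

text \<open>Each double sum is averaged with its transpose: this brings together \<open>|x i - q * x j|\<close> and
  \<open>|x j - q * x i|\<close>, as \<open>abs_q_difference_pair_le\<close> requires, and replaces the weights \<open>x i\<close> on the
  right by the symmetric \<open>x i + x j\<close>, for which Cauchy--Schwarz applies.\<close>

lemma q_weighted_sum_bound:
  fixes a b :: "'i \<Rightarrow> 'i \<Rightarrow> complex" and x :: "'i \<Rightarrow> real" and q l L :: real
  assumes q: "0 \<le> q" "q \<le> 1" and l: "0 \<le> l" and LL: "l \<le> L"
    and x: "\<And>i. i \<in> I \<Longrightarrow> l \<le> x i" "\<And>i. i \<in> I \<Longrightarrow> x i \<le> L"
    and a: "\<And>i j. cmod (a j i) = cmod (a i j)" and b: "\<And>i j. cmod (b j i) = cmod (b i j)"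
  shows "((L + q * l) * cmod (\<Sum>i\<in>I. \<Sum>j\<in>I. (x i - q * x j) *\<^sub>R (a i j * b j i)))\<^sup>2
    \<le> ((1 + q) * (L - q * l))\<^sup>2 *
      ((\<Sum>i\<in>I. \<Sum>j\<in>I. x i * (cmod (a i j))\<^sup>2) * (\<Sum>i\<in>I. \<Sum>j\<in>I. x i * (cmod (b i j))\<^sup>2))"
proof -
  let ?z = "\<lambda>i j. a i j * b j i"
  let ?S = "\<Sum>i\<in>I. \<Sum>j\<in>I. (x i - q * x j) *\<^sub>R ?z i j"
  let ?c = "(1 + q) * (L - q * l)"
  let ?T = "\<Sum>(i,j)\<in>I \<times> I. (x i + x j) * (cmod (a i j) * cmod (b i j))"
  have ql: "q * l \<le> L" "0 \<le> L" "0 \<le> q * l"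
    using mult_left_le_one_le[OF l q] q l LL by auto
  have x0: "0 \<le> x i" if "i \<in> I" for i using x(1)[OF that] l by simp
  let ?A = "\<Sum>i\<in>I. \<Sum>j\<in>I. \<bar>x i - q * x j\<bar> * (cmod (a i j) * cmod (b i j))"
  have "cmod ?S \<le> (\<Sum>i\<in>I. \<Sum>j\<in>I. cmod ((x i - q * x j) *\<^sub>R ?z i j))"
    by (intro sum_norm_le order.refl)
  also have "\<dots> = ?A"
    by (simp add: norm_mult b)
  finally have "2 * cmod ?S \<le> ?A + ?A" by simp
  also have "\<dots> = ?A + (\<Sum>i\<in>I. \<Sum>j\<in>I. \<bar>x j - q * x i\<bar> * (cmod (a i j) * cmod (b i j)))"
    by (subst (2) sum.swap) (simp add: a b)
  also have "\<dots> = (\<Sum>i\<in>I. \<Sum>j\<in>I.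
      (\<bar>x i - q * x j\<bar> + \<bar>x j - q * x i\<bar>) * (cmod (a i j) * cmod (b i j)))"
    by (simp add: sum.distrib distrib_right)
  finally have "(L + q * l) * (2 * cmod ?S) \<le> (L + q * l) * \<dots>"
    using ql by (intro mult_left_mono) auto
  also have "\<dots> = (\<Sum>i\<in>I. \<Sum>j\<in>I.
      ((L + q * l) * (\<bar>x i - q * x j\<bar> + \<bar>x j - q * x i\<bar>)) * (cmod (a i j) * cmod (b i j)))"
    by (simp only: sum_distrib_left mult.assoc)
  also have "\<dots> \<le> (\<Sum>i\<in>I. \<Sum>j\<in>I. (?c * (x i + x j)) * (cmod (a i j) * cmod (b i j)))"
    by (intro sum_mono mult_right_mono abs_q_difference_pair_le q l x mult_nonneg_nonneg norm_ge_zero)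
  also have "\<dots> = ?c * ?T"
    by (simp only: sum_distrib_left sum.cartesian_product split_def mult.assoc)
  finally have le: "(L + q * l) * (2 * cmod ?S) \<le> ?c * ?T" .
  have weights: "(\<Sum>(i,j)\<in>I \<times> I. (x i + x j) * (cmod (h i j))\<^sup>2) = 2 * (\<Sum>i\<in>I. \<Sum>j\<in>I. x i * (cmod (h i j))\<^sup>2)"
    if "\<And>i j. cmod (h j i) = cmod (h i j)" for h :: "'i \<Rightarrow> 'i \<Rightarrow> complex"
  proof -
    have "(\<Sum>i\<in>I. \<Sum>j\<in>I. x j * (cmod (h i j))\<^sup>2) = (\<Sum>i\<in>I. \<Sum>j\<in>I. x i * (cmod (h i j))\<^sup>2)"
      by (subst sum.swap) (simp add: that)
    then show ?thesis
      by (simp add: sum.cartesian_product[symmetric] distrib_right sum.distrib)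
  qed
  have "?T\<^sup>2 \<le> (\<Sum>(i,j)\<in>I \<times> I. (x i + x j) * (cmod (a i j))\<^sup>2) *
      (\<Sum>(i,j)\<in>I \<times> I. (x i + x j) * (cmod (b i j))\<^sup>2)"
    using Cauchy_Schwarz_ineq_weighted_sum[of "I \<times> I" "\<lambda>(i,j). x i + x j"
        "\<lambda>(i,j). cmod (a i j)" "\<lambda>(i,j). cmod (b i j)"] x0
    by (auto simp: split_def)
  then have T: "?T\<^sup>2 \<le> 2 * (\<Sum>i\<in>I. \<Sum>j\<in>I. x i * (cmod (a i j))\<^sup>2) *
      (2 * (\<Sum>i\<in>I. \<Sum>j\<in>I. x i * (cmod (b i j))\<^sup>2))"
    by (simp only: weights a b)
  have "((L + q * l) * (2 * cmod ?S))\<^sup>2 \<le> (?c * ?T)\<^sup>2"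
    using le ql by (intro power_mono) auto
  also have "\<dots> = ?c\<^sup>2 * ?T\<^sup>2" by (rule power_mult_distrib)
  also have "\<dots> \<le> ?c\<^sup>2 * (2 * (\<Sum>i\<in>I. \<Sum>j\<in>I. x i * (cmod (a i j))\<^sup>2) *
      (2 * (\<Sum>i\<in>I. \<Sum>j\<in>I. x i * (cmod (b i j))\<^sup>2)))"
    by (intro mult_left_mono T) simp
  finally show ?thesis by (simp add: power_mult_distrib mult_ac)
qed


section \<open>Traces in an orthonormal basis\<close>

lemma cinner_commute: "cinner y x = cnj (cinner x y)"
  by (simp add: cinner_def mult.commute)

lemma cinner_add_right: "cinner x (y + z) = cinner x y + cinner x z"
  by (simp add: cinner_def distrib_left sum.distrib)

lemma cinner_scale_right: "cinner x (c *s y) = c * cinner x y"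
  by (simp add: cinner_def sum_distrib_left mult_ac)

lemma cinner_zero_right: "cinner x 0 = 0"
  by (simp add: cinner_def)

lemma cinner_ctranspose: "cinner (ctranspose M *v x) y = cinner x (M *v y)"
proof -
  have "cinner (ctranspose M *v x) y = (\<Sum>j\<in>UNIV. \<Sum>i\<in>UNIV. cnj (x $ i) * M $ i $ j * y $ j)"
    by (simp add: cinner_def ctranspose_def sum_distrib_left matrix_vector_mult_def sum_distrib_right mult_ac)
  also have "\<dots> = (\<Sum>i\<in>UNIV. \<Sum>j\<in>UNIV. cnj (x $ i) * M $ i $ j * y $ j)"
    by (rule sum.swap)
  also have "\<dots> = cinner x (M *v y)"
    by (simp add: cinner_def matrix_vector_mult_def sum_distrib_left mult_ac)
  finally show ?thesis .
qed

lemma self_adjoint_cinner: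
  assumes "self_adjoint M"
  shows "cinner (M *v x) y = cinner x (M *v y)"
  using assms cinner_ctranspose[of M x y] by (simp add: self_adjoint_def)

lemma self_adjoint_cinner_cnj:
  assumes "self_adjoint M"
  shows "cinner y (M *v x) = cnj (cinner x (M *v y))"
  using cinner_commute[of "M *v y" x] by (simp add: self_adjoint_cinner[OF assms])

text \<open>Orthonormality gives the expansion for each \<open>y = \<phi> k\<close>, and both sides are linear in \<open>y\<close>,
  so it extends to the complex span.\<close>

lemma cinner_Parseval:
  fixes \<phi> :: "nat \<Rightarrow> complex ^ 'n"
  assumes "orthonormal_basis \<phi>"
  shows "cinner x y = (\<Sum>j=1..CARD('n). cinner x (\<phi> j) * cinner (\<phi> j) y)"
proof -
  let ?J = "{1..CARD('n)}"
  let ?P = "\<lambda>y. cinner x y = (\<Sum>j\<in>?J. cinner x (\<phi> j) * cinner (\<phi> j) y)"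
  have orth: "cinner (\<phi> i) (\<phi> j) = (if i = j then 1 else 0)" if "i \<in> ?J" "j \<in> ?J" for i j
    using assms that by (simp add: orthonormal_basis_def)
  have span: "y \<in> vec.span (\<phi> ` ?J)"
    using assms by (simp add: orthonormal_basis_def)
  show "?P y"
    using span
  proof (induction rule: vec.span_induct_alt)
    case base
    show ?case by (simp add: cinner_zero_right)
  next
    case (step c v w)
    then obtain k where k: "k \<in> ?J" "v = \<phi> k" by blast
    have "(\<Sum>j\<in>?J. cinner x (\<phi> j) * cinner (\<phi> j) v) = (\<Sum>j\<in>?J. if j = k then cinner x v else 0)"
      using k orth by (intro sum.cong) auto
    also have "\<dots> = cinner x v" using k by simp
    finally have "cinner x v = (\<Sum>j\<in>?J. cinner x (\<phi> j) * cinner (\<phi> j) v)" ..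
    then show ?case
      using step.IH
      by (simp add: cinner_add_right cinner_scale_right distrib_left sum.distrib sum_distrib_left mult_ac)
  qed
qed

lemma trace_ketbra_mult: "trace (ketbra x y ** M) = cinner y (M *v x)"
proof -
  have "trace (ketbra x y ** M) = (\<Sum>i\<in>UNIV. \<Sum>k\<in>UNIV. cnj (y $ k) * M $ k $ i * x $ i)"
    by (simp add: trace_def ketbra_def matrix_matrix_mult_def mult_ac)
  also have "\<dots> = (\<Sum>k\<in>UNIV. \<Sum>i\<in>UNIV. cnj (y $ k) * M $ k $ i * x $ i)"
    by (rule sum.swap)
  also have "\<dots> = cinner y (M *v x)"
    by (simp add: cinner_def matrix_vector_mult_def sum_distrib_left mult_ac)
  finally show ?thesis .
qed

lemma trace_scaleR: "trace (c *\<^sub>R M) = c *\<^sub>R trace (M :: complex ^ 'n ^ 'n)"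
  by (simp add: trace_def scaleR_sum_right)

lemma matrix_add_rdistrib: "(A + B) ** C = A ** C + B ** (C :: complex ^ 'n ^ 'n)"
  by (simp add: matrix_matrix_mult_def vec_eq_iff distrib_right sum.distrib)

lemma matrix_diff_ldistrib: "A ** (B - C) = A ** B - A ** (C :: complex ^ 'n ^ 'n)"
  by (simp add: matrix_matrix_mult_def vec_eq_iff right_diff_distrib sum_subtractf)

lemma trace_spectral_mult:
  fixes M :: "complex ^ 'n ^ 'n"
  shows "trace ((\<Sum>i\<in>I. \<mu> i *\<^sub>R ketbra (\<phi> i) (\<phi> i)) ** M) = (\<Sum>i\<in>I. \<mu> i *\<^sub>R cinner (\<phi> i) (M *v \<phi> i))"
proof (induction I rule: infinite_finite_induct)
  case (insert i I)
  then show ?case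
    by (simp add: matrix_add_rdistrib trace_add scalar_matrix_assoc[symmetric] trace_scaleR trace_ketbra_mult)
qed (simp_all add: trace_def)

text \<open>This is the product rule for matrix entries in the basis \<open>\<phi>\<close>. Moving the self-adjoint \<open>X\<close>
  to the left argument reduces it to Parseval's identity.\<close>

lemma cinner_mult_expand:
  fixes \<phi> :: "nat \<Rightarrow> complex ^ 'n"
  assumes "orthonormal_basis \<phi>" "self_adjoint X"
  shows "cinner x ((X ** Y) *v y) = (\<Sum>j=1..CARD('n). cinner x (X *v \<phi> j) * cinner (\<phi> j) (Y *v y))"
proof -
  have "cinner x ((X ** Y) *v y) = cinner (X *v x) (Y *v y)"
    by (simp add: self_adjoint_cinner[OF assms(2)] matrix_vector_mul_assoc)
  also have "\<dots> = (\<Sum>j=1..CARD('n). cinner (X *v x) (\<phi> j) * cinner (\<phi> j) (Y *v y))"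
    by (rule cinner_Parseval[OF assms(1)])
  finally show ?thesis
    by (simp add: self_adjoint_cinner[OF assms(2)])
qed

text \<open>Exchanging the summation indices in the trace of \<open>\<rho> ** (Y ** X)\<close> brings it to the same
  entries as that of \<open>\<rho> ** (X ** Y)\<close>, but with \<open>\<mu> j\<close> in place of \<open>\<mu> i\<close>.\<close>

lemma trace_qcomm_expand:
  fixes \<phi> :: "nat \<Rightarrow> complex ^ 'n" and \<rho> X Y :: "complex ^ 'n ^ 'n"
  assumes \<phi>: "orthonormal_basis \<phi>"
    and spectral: "\<rho> = (\<Sum>i=1..CARD('n). \<mu> i *\<^sub>R ketbra (\<phi> i) (\<phi> i))"
    and X: "self_adjoint X" and Y: "self_adjoint Y"
  shows "trace (\<rho> ** qcomm r X Y) = (\<Sum>i=1..CARD('n). \<Sum>j=1..CARD('n).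
    (\<mu> i - r * \<mu> j) *\<^sub>R (cinner (\<phi> i) (X *v \<phi> j) * cinner (\<phi> j) (Y *v \<phi> i)))"
proof -
  let ?J = "{1..CARD('n)}"
  let ?a = "\<lambda>i j. cinner (\<phi> i) (X *v \<phi> j)"
  let ?b = "\<lambda>i j. cinner (\<phi> i) (Y *v \<phi> j)"
  have XY: "trace (\<rho> ** (X ** Y)) = (\<Sum>i\<in>?J. \<Sum>j\<in>?J. \<mu> i *\<^sub>R (?a i j * ?b j i))"
    by (simp add: spectral trace_spectral_mult cinner_mult_expand[OF \<phi> X] scaleR_sum_right)
  have "trace (\<rho> ** (Y ** X)) = (\<Sum>i\<in>?J. \<Sum>j\<in>?J. \<mu> i *\<^sub>R (?b i j * ?a j i))"
    by (simp add: spectral trace_spectral_mult cinner_mult_expand[OF \<phi> Y] scaleR_sum_right)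
  also have "\<dots> = (\<Sum>i\<in>?J. \<Sum>j\<in>?J. \<mu> j *\<^sub>R (?a i j * ?b j i))"
    by (subst sum.swap) (simp add: mult_ac)
  finally have YX: "trace (\<rho> ** (Y ** X)) = \<dots>" .
  have "trace (\<rho> ** qcomm r X Y) = trace (\<rho> ** (X ** Y)) - r *\<^sub>R trace (\<rho> ** (Y ** X))"
    by (simp add: qcomm_def matrix_diff_ldistrib matrix_scalar_ac scalar_matrix_assoc[symmetric] trace_sub trace_scaleR)
  then show ?thesis
    unfolding XY YX
    by (simp add: scaleR_sum_right sum_subtractf[symmetric] scaleR_diff_left)
qed

lemma trace_square_expand:
  fixes \<phi> :: "nat \<Rightarrow> complex ^ 'n" and \<rho> X :: "complex ^ 'n ^ 'n"
  assumes \<phi>: "orthonormal_basis \<phi>"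
    and spectral: "\<rho> = (\<Sum>i=1..CARD('n). \<mu> i *\<^sub>R ketbra (\<phi> i) (\<phi> i))"
    and X: "self_adjoint X"
  shows "Re (trace (\<rho> ** (X ** X)))
    = (\<Sum>i=1..CARD('n). \<Sum>j=1..CARD('n). \<mu> i * (cmod (cinner (\<phi> i) (X *v \<phi> j)))\<^sup>2)"
proof -
  have "cinner (\<phi> j) (X *v \<phi> i) = cnj (cinner (\<phi> i) (X *v \<phi> j))" for i j
    by (rule self_adjoint_cinner_cnj[OF X])
  then have "Re (cinner (\<phi> i) (X *v \<phi> j) * cinner (\<phi> j) (X *v \<phi> i)) = (cmod (cinner (\<phi> i) (X *v \<phi> j)))\<^sup>2" for i j
    by (metis Re_complex_of_real complex_norm_square of_real_power)
  then show ?thesis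
    by (simp add: spectral trace_spectral_mult cinner_mult_expand[OF \<phi> X] sum_distrib_left)
qed


section \<open>Centered observables and the uncertainty relation\<close>

lemma trace_mult_mat: "trace (M ** mat c) = c * trace (M :: complex ^ 'n ^ 'n)"
  by (simp add: trace_def matrix_matrix_mult_def mat_def if_distrib sum.delta' sum_distrib_left mult.commute cong: if_cong)

lemma trace_mult_centered: "trace (M ** centered \<rho> A) = trace (M ** A) - trace (\<rho> ** A) * trace M"
  by (simp add: centered_def matrix_diff_ldistrib trace_sub trace_mult_mat)

lemma self_adjoint_centered:
  assumes "self_adjoint \<rho>" "self_adjoint A"
  shows "self_adjoint (centered \<rho> A)"
  using assms cnj_trace_mult[OF assms]
  by (auto simp: self_adjoint_def centered_def ctranspose_def mat_def vec_eq_iff)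

text \<open>The second factor \<open>centered \<rho> A\<close> may be replaced by \<open>A\<close>, as the first has mean \<open>0\<close>.\<close>

lemma variance_eq_trace_centered_square:
  assumes "trace \<rho> = 1"
  shows "variance \<rho> A = Re (trace (\<rho> ** (centered \<rho> A ** centered \<rho> A)))"
proof -
  let ?A = "centered \<rho> A"
  have "trace (\<rho> ** (?A ** ?A)) = trace ((\<rho> ** ?A) ** A) - trace (\<rho> ** A) * trace (\<rho> ** ?A)"
    by (simp add: matrix_mul_assoc trace_mult_centered)
  also have "trace (\<rho> ** ?A) = 0"
    by (simp add: trace_mult_centered assms)
  also have "trace ((\<rho> ** ?A) ** A) = trace ((A ** \<rho>) ** ?A)"
    by (metis matrix_mul_assoc trace_mul_sym)
  also have "\<dots> = trace (A ** \<rho> ** A) - trace (\<rho> ** A) * trace (A ** \<rho>)"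
    by (rule trace_mult_centered)
  also have "\<dots> = trace (\<rho> ** (A ** A)) - (trace (\<rho> ** A))\<^sup>2"
    by (metis matrix_mul_assoc trace_mul_sym power2_eq_square)
  finally have "trace (\<rho> ** (?A ** ?A)) = trace (\<rho> ** (A ** A)) - (trace (\<rho> ** A))\<^sup>2"
    by simp
  then show ?thesis by (simp add: variance_def)
qed

lemma variance_nonneg:
  fixes \<phi> :: "nat \<Rightarrow> complex ^ 'n" and \<rho> A :: "complex ^ 'n ^ 'n"
  assumes \<rho>: "density_matrix \<rho>"
    and \<phi>: "orthonormal_basis \<phi>"
    and spectral: "\<rho> = (\<Sum>i=1..CARD('n). \<mu> i *\<^sub>R ketbra (\<phi> i) (\<phi> i))"
    and nonneg: "\<And>i. i \<in> {1..CARD('n)} \<Longrightarrow> 0 \<le> \<mu> i"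
    and A: "self_adjoint A"
  shows "0 \<le> variance \<rho> A"
proof -
  have "trace \<rho> = 1" "self_adjoint \<rho>"
    using \<rho> by (auto simp: density_matrix_def pos_semidef_def)
  then show ?thesis
    by (auto simp: variance_eq_trace_centered_square self_adjoint_centered A
        trace_square_expand[OF \<phi> spectral] intro!: sum_nonneg mult_nonneg_nonneg nonneg)
qed

text \<open>If \<open>L = q l\<close>, the quotient is a division by zero with value \<open>0\<close>, and the claim is that
  variances are nonnegative.\<close>

lemma uncertainty_qcomm:
  fixes \<phi> :: "nat \<Rightarrow> complex ^ 'n" and \<rho> A B :: "complex ^ 'n ^ 'n" and q l L :: real
  assumes \<rho>: "density_matrix \<rho>"
    and \<phi>: "orthonormal_basis \<phi>"
    and spectral: "\<rho> = (\<Sum>i=1..CARD('n). \<mu> i *\<^sub>R ketbra (\<phi> i) (\<phi> i))"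
    and bounds: "\<And>i. i \<in> {1..CARD('n)} \<Longrightarrow> l \<le> \<mu> i" "\<And>i. i \<in> {1..CARD('n)} \<Longrightarrow> \<mu> i \<le> L"
    and l: "0 \<le> l"
    and q: "0 \<le> q" "q \<le> 1"
    and A: "self_adjoint A" and B: "self_adjoint B"
  shows "(L + q * l)\<^sup>2 / ((1 + q)\<^sup>2 * (L - q * l)\<^sup>2) *
      (cmod (trace (\<rho> ** qcomm q (centered \<rho> A) (centered \<rho> B))))\<^sup>2
    \<le> variance \<rho> A * variance \<rho> B"
proof -
  have tr: "trace \<rho> = 1" and sa: "self_adjoint \<rho>"
    using \<rho> by (auto simp: density_matrix_def pos_semidef_def)
  have A0: "self_adjoint (centered \<rho> A)" and B0: "self_adjoint (centered \<rho> B)"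
    using sa A B by (auto intro: self_adjoint_centered)
  have "1 \<in> {1..CARD('n)}" using zero_less_card_finite[where 'a='n] by simp
  with bounds have LL: "l \<le> L" by (meson order_trans)
  have cmod_sym: "cmod (cinner (\<phi> j) (X *v \<phi> i)) = cmod (cinner (\<phi> i) (X *v \<phi> j))"
    if "self_adjoint X" for X i j
    using self_adjoint_cinner_cnj[OF that, of "\<phi> j" "\<phi> i"] by simp
  let ?t = "cmod (trace (\<rho> ** qcomm q (centered \<rho> A) (centered \<rho> B)))"
  have key: "((L + q * l) * ?t)\<^sup>2 \<le> ((1 + q) * (L - q * l))\<^sup>2 * (variance \<rho> A * variance \<rho> B)"
    unfolding trace_qcomm_expand[OF \<phi> spectral A0 B0] variance_eq_trace_centered_square[OF tr]
      trace_square_expand[OF \<phi> spectral A0] trace_square_expand[OF \<phi> spectral B0]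
    by (intro q_weighted_sum_bound q l LL bounds cmod_sym A0 B0)
  have V: "0 \<le> variance \<rho> A * variance \<rho> B"
    using bounds(1) l variance_nonneg[OF \<rho> \<phi> spectral _ A] variance_nonneg[OF \<rho> \<phi> spectral _ B]
    by (meson mult_nonneg_nonneg order_trans)
  show ?thesis
  proof (cases "L - q * l = 0")
    case True
    then show ?thesis using V by simp
  next
    case False
    then have "0 < ((1 + q) * (L - q * l))\<^sup>2" using q by simp
    with key show ?thesis
      by (simp add: power_mult_distrib divide_le_eq mult_ac)
  qed
qed

lemma qcomm_inverse:
  assumes "r \<noteq> 0"
  shows "qcomm r Y X = (- r) *\<^sub>R qcomm (1 / r) X Y"
  using assms by (simp add: qcomm_def scaleR_diff_right)

theorem theorem2p1:
  fixes \<rho> A B :: "complex ^ 'n ^ 'n"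
    and \<mu> :: "nat \<Rightarrow> real" and \<phi> :: "nat \<Rightarrow> complex ^ 'n"
    and n :: nat and q :: real
  assumes n: "n = CARD('n)"
    and \<rho>: "density_matrix \<rho>"
    and \<phi>: "orthonormal_basis \<phi>"
    and spectral: "\<rho> = (\<Sum>i=1..n. \<mu> i *\<^sub>R ketbra (\<phi> i) (\<phi> i))"
    and nonneg: "0 \<le> \<mu> 1"
    and sorted: "\<And>i j. 1 \<le> i \<Longrightarrow> i \<le> j \<Longrightarrow> j \<le> n \<Longrightarrow> \<mu> i \<le> \<mu> j"
    and A: "self_adjoint A"
    and B: "self_adjoint B"
  shows "(\<bar>q\<bar> \<le> 1 \<longrightarrow>
      (\<mu> n + \<bar>q\<bar> * \<mu> 1)\<^sup>2 / ((1 + \<bar>q\<bar>)\<^sup>2 * (\<mu> n - \<bar>q\<bar> * \<mu> 1)\<^sup>2) *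
        (cmod (trace (\<rho> ** qcomm \<bar>q\<bar> (centered \<rho> A) (centered \<rho> B))))\<^sup>2
      \<le> variance \<rho> A * variance \<rho> B) \<and>
    (\<bar>q\<bar> > 1 \<longrightarrow>
      q\<^sup>2 * (\<bar>q\<bar> * \<mu> n + \<mu> 1)\<^sup>2 / ((1 + \<bar>q\<bar>)\<^sup>2 * (\<bar>q\<bar> * \<mu> n - \<mu> 1)\<^sup>2) *
        (cmod (trace (\<rho> ** qcomm (1 / \<bar>q\<bar>) (centered \<rho> A) (centered \<rho> B))))\<^sup>2
      = (\<bar>q\<bar> * \<mu> n + \<mu> 1)\<^sup>2 / ((1 + \<bar>q\<bar>)\<^sup>2 * (\<bar>q\<bar> * \<mu> n - \<mu> 1)\<^sup>2) *
        (cmod (trace (\<rho> ** qcomm \<bar>q\<bar> (centered \<rho> B) (centered \<rho> A))))\<^sup>2 \<and>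
      (\<bar>q\<bar> * \<mu> n + \<mu> 1)\<^sup>2 / ((1 + \<bar>q\<bar>)\<^sup>2 * (\<bar>q\<bar> * \<mu> n - \<mu> 1)\<^sup>2) *
        (cmod (trace (\<rho> ** qcomm \<bar>q\<bar> (centered \<rho> B) (centered \<rho> A))))\<^sup>2
      \<le> variance \<rho> A * variance \<rho> B)"
proof -
  have bounds: "\<mu> 1 \<le> \<mu> i" "\<mu> i \<le> \<mu> n" if "i \<in> {1..CARD('n)}" for i
    using sorted that n by auto
  note uncertainty = uncertainty_qcomm[OF \<rho> \<phi> spectral[unfolded n] bounds[unfolded n] nonneg _ _ A B,
      folded n]
  have case2: "q\<^sup>2 * (\<bar>q\<bar> * \<mu> n + \<mu> 1)\<^sup>2 / ((1 + \<bar>q\<bar>)\<^sup>2 * (\<bar>q\<bar> * \<mu> n - \<mu> 1)\<^sup>2) *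
        (cmod (trace (\<rho> ** qcomm (1 / \<bar>q\<bar>) (centered \<rho> A) (centered \<rho> B))))\<^sup>2
      = (\<bar>q\<bar> * \<mu> n + \<mu> 1)\<^sup>2 / ((1 + \<bar>q\<bar>)\<^sup>2 * (\<bar>q\<bar> * \<mu> n - \<mu> 1)\<^sup>2) *
        (cmod (trace (\<rho> ** qcomm \<bar>q\<bar> (centered \<rho> B) (centered \<rho> A))))\<^sup>2"
    "q\<^sup>2 * (\<bar>q\<bar> * \<mu> n + \<mu> 1)\<^sup>2 / ((1 + \<bar>q\<bar>)\<^sup>2 * (\<bar>q\<bar> * \<mu> n - \<mu> 1)\<^sup>2) *
        (cmod (trace (\<rho> ** qcomm (1 / \<bar>q\<bar>) (centered \<rho> A) (centered \<rho> B))))\<^sup>2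
      \<le> variance \<rho> A * variance \<rho> B" if q: "\<bar>q\<bar> > 1"
  proof -
    define r where "r = \<bar>q\<bar>"
    have r: "r > 1" "r \<noteq> 0" "q\<^sup>2 = r\<^sup>2" using q by (auto simp: r_def)
    let ?t = "cmod (trace (\<rho> ** qcomm (1 / r) (centered \<rho> A) (centered \<rho> B)))"
    have "trace (\<rho> ** qcomm r (centered \<rho> B) (centered \<rho> A))
        = (- r) *\<^sub>R trace (\<rho> ** qcomm (1 / r) (centered \<rho> A) (centered \<rho> B))"
      by (simp only: qcomm_inverse[OF r(2)] matrix_scalar_ac scalar_matrix_assoc[symmetric] trace_scaleR)
    then have "cmod (trace (\<rho> ** qcomm r (centered \<rho> B) (centered \<rho> A))) = r * ?t"
      using r(1) by (simp add: norm_mult)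
    then show "q\<^sup>2 * (\<bar>q\<bar> * \<mu> n + \<mu> 1)\<^sup>2 / ((1 + \<bar>q\<bar>)\<^sup>2 * (\<bar>q\<bar> * \<mu> n - \<mu> 1)\<^sup>2) *
        (cmod (trace (\<rho> ** qcomm (1 / \<bar>q\<bar>) (centered \<rho> A) (centered \<rho> B))))\<^sup>2
      = (\<bar>q\<bar> * \<mu> n + \<mu> 1)\<^sup>2 / ((1 + \<bar>q\<bar>)\<^sup>2 * (\<bar>q\<bar> * \<mu> n - \<mu> 1)\<^sup>2) *
        (cmod (trace (\<rho> ** qcomm \<bar>q\<bar> (centered \<rho> B) (centered \<rho> A))))\<^sup>2"
      unfolding r(3) r_def[symmetric] by (simp add: power_mult_distrib)
    have scale: "r * (\<mu> n + 1 / r * \<mu> 1) = r * \<mu> n + \<mu> 1" "r * (1 + 1 / r) = 1 + r"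
      "r * (\<mu> n - 1 / r * \<mu> 1) = r * \<mu> n - \<mu> 1"
      using r by (simp_all add: field_simps)
    have cancel: "r\<^sup>2 * (r\<^sup>2 * X) / (r\<^sup>2 * Y * (r\<^sup>2 * Z)) = X / (Y * Z)" for X Y Z :: real
      using r(2) by (simp add: power2_eq_square)
    \<comment> \<open>Multiply numerator and denominator of the fraction for \<open>1 / r\<close> by \<open>r\<^sup>4\<close>.\<close>
    have "r\<^sup>2 * (r * \<mu> n + \<mu> 1)\<^sup>2 / ((1 + r)\<^sup>2 * (r * \<mu> n - \<mu> 1)\<^sup>2)
        = (\<mu> n + 1 / r * \<mu> 1)\<^sup>2 / ((1 + 1 / r)\<^sup>2 * (\<mu> n - 1 / r * \<mu> 1)\<^sup>2)"
      unfolding scale[symmetric] power_mult_distrib by (rule cancel)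
    then show "q\<^sup>2 * (\<bar>q\<bar> * \<mu> n + \<mu> 1)\<^sup>2 / ((1 + \<bar>q\<bar>)\<^sup>2 * (\<bar>q\<bar> * \<mu> n - \<mu> 1)\<^sup>2) *
        (cmod (trace (\<rho> ** qcomm (1 / \<bar>q\<bar>) (centered \<rho> A) (centered \<rho> B))))\<^sup>2
      \<le> variance \<rho> A * variance \<rho> B"
      unfolding r(3) r_def[symmetric] using uncertainty[of "1 / r"] r(1) by simp
  qed
  show ?thesis
    using uncertainty[of "\<bar>q\<bar>"] case2(1) ord_eq_le_trans[OF case2(1)[symmetric] case2(2)]
    by (intro conjI impI) simp_all
qed

end
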